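(* Let $\Phi$ be a consistent set of formulas. For every formula $\varphi$ that is a Horn clause or a w-Horn clause, if $\Phi\vdash\varphi$, then $\|\varphi\|^{\mathbf{B}}_{\mathbf{T}^{\Phi},e^{\Phi}}=1$.
   Context: **Logic.** MTL is the monoidal t-norm based logic, with algebraic semantics given by MTL-algebras, i.e. bounded integral commutative residuated lattices $(A,\sqcap,\sqcup,*,\Rightarrow,0,1)$ satisfying $(x\Rightarrow y)\sqcup(y\Rightarrow x)=1$; the connectives $\wedge$ (weak conjunction), $\vee$, $\&$ (strong conjunction), $\rightarrow,\overline 0,\overline 1$ are interpreted by $\sqcap,\sqcup,*,\Rightarrow,0,1$. $L$ is a fixed core fuzzy logic (an expansion of MTL with the congruence property for $\leftrightarrow$ and the local deduction theorem: $T,\varphi\vdash\psi$ iff $T\vdash\varphi^n\rightarrow\psi$ for some $n$) whose propositional language contains only the truth-constants $\overline 1$ and $\overline 0$. A predicate language consists of a nonempty set of predicate symbols, a set of function symbols, and arities (0-ary function symbols are individual constants, 0-ary predicate symbols are truth constants). Terms, atomic formulas and formulas are as in classical predicate logic; $Var$ is the set of object variables. The predicate logic $L\forall^m$ has as axioms the first-order instances of the axioms of $L$ and ($\forall1$) $(\forall x)\varphi(x)\rightarrow\varphi(t)$, ($\exists1$) $\varphi(t)\rightarrow(\exists x)\varphi(x)$ ($t$ substitutable for $x$ in $\varphi$), ($\forall2$) $(\forall x)(\xi\rightarrow\varphi)\rightarrow(\xi\rightarrow(\forall x)\varphi)$, ($\exists2$) $(\forall x)(\varphi\rightarrow\xi)\rightarrow((\exists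 x)\varphi\rightarrow\xi)$ ($x$ not free in $\xi$); its rules are those of $L$ and generalization (from $\varphi$ infer $(\forall x)\varphi$). Proof and provability are defined analogously to the classical notions; $\Phi\vdash\varphi$ denotes provability in $L\forall^m$ from $\Phi$. $\Phi$ is consistent if $\Phi\not\vdash\overline 0$. **Similarity.** The language has a binary predicate symbol $\approx$ interpreted as a similarity, and the axiomatization of $L\forall^m$ contains the axioms: $(\forall x)\,x\approx x$; $(\forall x)(\forall y)(x\approx y\rightarrow y\approx x)$; $(\forall x)(\forall y)(\forall z)(x\approx y\,\&\,y\approx z\rightarrow x\approx z)$; for each $n$-ary function symbol $F$, the universal closure of $x_1\approx y_1\&\cdots\&x_n\approx y_n\rightarrow F(x_1,\dots,x_n)\approx F(y_1,\dots,y_n)$; for each $n$-ary predicate symbol $P$, the universal closure of $x_1\approx y_1\&\cdots\&x_n\approx y_n\rightarrow(P(x_1,\dots,x_n)\leftrightarrow P(y_1,\dots,y_n))$. **Semantics.** For an algebra $\mathbf A$, an $\mathbf A$-structure $\mathbf M$ has a nonempty domain $M$, a function $P_{\mathbf M}:M^n\to\mathbf A$ for each $n$-ary predicate symbol $P$ (an element of $\mathbf{A}$ if $n=0$), and $F_{\mathbf M}:M^n\to M$ for each $n$-ary function symbol $F$. For an evaluation $v:Var\to M$, values $\|t\|^{\mathbf A}_{\mathbf M,v}$ and truth values $\|\varphi\|^{\mathbf A}_{\mathbf M,v}$ are defined recursively as usual, connectives being interpreted by the operations of $\mathbf A$, $\forall$ by infimum and $\exists$ by supremum over $M$. **Term structure.**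 For a set of formulas $\Phi$ and terms $t_1,t_2$, put $t_1\sim t_2$ iff $\Phi\vdash t_1\approx t_2$; this is an equivalence relation, and $\overline t$ is the class of $t$. For consistent $\Phi$, the term structure $\langle\mathbf B,\mathbf T^\Phi\rangle$ associated to $\Phi$ has $\mathbf B$ the two-valued Boolean algebra, domain $T^\Phi$ the set of all $\sim$-classes of terms, $F_{\mathbf T^\Phi}(\overline t_1,\dots,\overline t_n)=\overline{F(t_1,\dots,t_n)}$, and $P_{\mathbf T^\Phi}(\overline t_1,\dots,\overline t_n)=1$ if $\Phi\vdash P(t_1,\dots,t_n)$ and $0$ otherwise (this is well defined). The canonical evaluation $e^\Phi$ is $e^\Phi(x)=\overline x$ for every $x\in Var$. **Horn clauses.** A basic Horn formula is a formula $\alpha_1\&\cdots\&\alpha_n\rightarrow\beta$ with $n\in\mathbb N$ and $\alpha_1,\dots,\alpha_n,\beta$ atomic (for $n=0$ it is just the atomic formula $\beta$); a basic w-Horn formula is the same with $\wedge$ in place of $\&$. A quantifier-free Horn formula is $\phi_1\&\cdots\&\phi_m$ with each $\phi_i$ a basic Horn formula; a quantifier-free w-Horn formula is $\phi_1\wedge\cdots\wedge\phi_m$ with each $\phi_i$ a basic w-Horn formula. A (w-)Horn clause is a formula $Q\gamma$ with $Q$ a (possibly empty) string of universal quantifiers and $\gamma$ a quantifier-free (w-)Horn formula; it may have free variables. *)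

theory Defs
  imports Main
begin

section \<open>Propositional logic\<close>

text \<open>
  The type parameter \<open>'c\<close> names the connectives that a logic adds to those of MTL. The truth
  constant \<open>1\<close> and the disjunction are primitive, with their usual definitions in MTL as axioms.
\<close>

datatype 'c pfm =
    PVar nat
  | PZero
  | POne
  | PAnd "'c pfm" "'c pfm"  (infixr \<open>\<and>\<^sub>p\<close> 55)
  | POr "'c pfm" "'c pfm"  (infixr \<open>\<or>\<^sub>p\<close> 53)
  | PAmp "'c pfm" "'c pfm"  (infixr \<open>&\<^sub>p\<close> 60)
  | PImp "'c pfm" "'c pfm"  (infixr \<open>\<rightarrow>\<^sub>p\<close> 52)
  | PConn 'c "'c pfm list"

abbreviation PIff :: "'c pfm \<Rightarrow> 'c pfm \<Rightarrow> 'c pfm"  (infix \<open>\<leftrightarrow>\<^sub>p\<close> 51) where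
  "a \<leftrightarrow>\<^sub>p b \<equiv> (a \<rightarrow>\<^sub>p b) &\<^sub>p (b \<rightarrow>\<^sub>p a)"

primrec ppow :: "'c pfm \<Rightarrow> nat \<Rightarrow> 'c pfm" where
  "ppow a 0 = POne"
| "ppow a (Suc n) = a &\<^sub>p ppow a n"

fun psubst :: "(nat \<Rightarrow> 'c pfm) \<Rightarrow> 'c pfm \<Rightarrow> 'c pfm" where
  "psubst s (PVar i) = s i"
| "psubst s PZero = PZero"
| "psubst s POne = POne"
| "psubst s (a \<and>\<^sub>p b) = psubst s a \<and>\<^sub>p psubst s b"
| "psubst s (a \<or>\<^sub>p b) = psubst s a \<or>\<^sub>p psubst s b"
| "psubst s (a &\<^sub>p b) = psubst s a &\<^sub>p psubst s b"
| "psubst s (a \<rightarrow>\<^sub>p b) = psubst s a \<rightarrow>\<^sub>p psubst s b"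
| "psubst s (PConn c as) = PConn c (map (psubst s) as)"

text \<open>
  A logic is given by a Hilbert-style presentation: \<open>conns\<close> are its connectives beyond those of
  MTL, and its axioms and rules (sets of premises with a conclusion) are schemata in the
  variables \<open>PVar\<close>.
\<close>

record 'c plogic =
  conns :: "'c set"
  conn_ar :: "'c \<Rightarrow> nat"
  axs :: "'c pfm set"
  rls :: "('c pfm set \<times> 'c pfm) set"

fun pwf :: "'c plogic \<Rightarrow> 'c pfm \<Rightarrow> bool" where
  "pwf L (PVar i) = True"
| "pwf L PZero = True"
| "pwf L POne = True"
| "pwf L (a \<and>\<^sub>p b) = (pwf L a \<and> pwf L b)"
| "pwf L (a \<or>\<^sub>p b) = (pwf L a \<and> pwf L b)"
| "pwf L (a &\<^sub>p b) = (pwf L a \<and> pwf L b)"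
| "pwf L (a \<rightarrow>\<^sub>p b) = (pwf L a \<and> pwf L b)"
| "pwf L (PConn c as) = (c \<in> conns L \<and> length as = conn_ar L c \<and> (\<forall>a\<in>set as. pwf L a))"

inductive pprov :: "'c plogic \<Rightarrow> 'c pfm set \<Rightarrow> 'c pfm \<Rightarrow> bool" for L T where
  hyp: "a \<in> T \<Longrightarrow> pprov L T a"
| ax: "a \<in> axs L \<Longrightarrow> \<forall>i. pwf L (s i) \<Longrightarrow> pprov L T (psubst s a)"
| rule: "(P, a) \<in> rls L \<Longrightarrow> \<forall>i. pwf L (s i) \<Longrightarrow> (\<And>b. b \<in> P \<Longrightarrow> pprov L T (psubst s b))
    \<Longrightarrow> pprov L T (psubst s a)"

text \<open>The axioms of Esteva and Godo for MTL, with modus ponens as the only rule.\<close>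

definition mtl_axioms :: "'c pfm set" where
  "mtl_axioms = (let p = PVar 0; q = PVar 1; r = PVar 2 in
    {(p \<rightarrow>\<^sub>p q) \<rightarrow>\<^sub>p (q \<rightarrow>\<^sub>p r) \<rightarrow>\<^sub>p p \<rightarrow>\<^sub>p r,
     p &\<^sub>p q \<rightarrow>\<^sub>p p,
     p &\<^sub>p q \<rightarrow>\<^sub>p q &\<^sub>p p,
     p \<and>\<^sub>p q \<rightarrow>\<^sub>p p,
     p \<and>\<^sub>p q \<rightarrow>\<^sub>p q \<and>\<^sub>p p,
     p &\<^sub>p (p \<rightarrow>\<^sub>p q) \<rightarrow>\<^sub>p p \<and>\<^sub>p q,
     (p \<rightarrow>\<^sub>p q \<rightarrow>\<^sub>p r) \<rightarrow>\<^sub>p p &\<^sub>p q \<rightarrow>\<^sub>p r,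
     (p &\<^sub>p q \<rightarrow>\<^sub>p r) \<rightarrow>\<^sub>p p \<rightarrow>\<^sub>p q \<rightarrow>\<^sub>p r,
     ((p \<rightarrow>\<^sub>p q) \<rightarrow>\<^sub>p r) \<rightarrow>\<^sub>p ((q \<rightarrow>\<^sub>p p) \<rightarrow>\<^sub>p r) \<rightarrow>\<^sub>p r,
     PZero \<rightarrow>\<^sub>p p,
     p \<or>\<^sub>p q \<rightarrow>\<^sub>p ((p \<rightarrow>\<^sub>p q) \<rightarrow>\<^sub>p q) \<and>\<^sub>p ((q \<rightarrow>\<^sub>p p) \<rightarrow>\<^sub>p p),
     ((p \<rightarrow>\<^sub>p q) \<rightarrow>\<^sub>p q) \<and>\<^sub>p ((q \<rightarrow>\<^sub>p p) \<rightarrow>\<^sub>p p) \<rightarrow>\<^sub>p p \<or>\<^sub>p q,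
     POne})"

definition mtl_rules :: "('c pfm set \<times> 'c pfm) set" where
  "mtl_rules = {({PVar 0, PVar 0 \<rightarrow>\<^sub>p PVar 1}, PVar 1)}"

text \<open>
  \<open>L\<close> expands MTL if it proves whatever MTL proves. MTL is taken here over the formulas of \<open>L\<close>;
  as \<open>L\<close> is closed under substitution, this is the same as taking only the formulas of MTL.
\<close>

definition expands_mtl :: "'c plogic \<Rightarrow> bool" where
  "expands_mtl L \<longleftrightarrow> (\<forall>T a. T \<subseteq> Collect (pwf L) \<longrightarrow>
     pprov (L\<lparr>axs := mtl_axioms, rls := mtl_rules\<rparr>) T a \<longrightarrow> pprov L T a)"

definition congruence_property :: "'c plogic \<Rightarrow> bool" where
  "congruence_property L \<longleftrightarrow> (\<forall>a b d i. pwf L a \<longrightarrow> pwf L b \<longrightarrow> pwf L d \<longrightarrow>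
     pprov L {a \<leftrightarrow>\<^sub>p b} (psubst (PVar(i := a)) d \<leftrightarrow>\<^sub>p psubst (PVar(i := b)) d))"

definition local_deduction_theorem :: "'c plogic \<Rightarrow> bool" where
  "local_deduction_theorem L \<longleftrightarrow>
     (\<forall>T a b. T \<subseteq> Collect (pwf L) \<longrightarrow> pwf L a \<longrightarrow> pwf L b \<longrightarrow>
        (pprov L (insert a T) b \<longleftrightarrow> (\<exists>n. pprov L T (ppow a n \<rightarrow>\<^sub>p b))))"

text \<open>
  The condition on arities says that the truth constants \<open>0\<close> and \<open>1\<close> are the only nullary
  connectives.
\<close>

definition core_fuzzy_logic :: "'c plogic \<Rightarrow> bool" where
  "core_fuzzy_logic L \<longleftrightarrow>
     (\<forall>c\<in>conns L. conn_ar L c > 0) \<and>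
     axs L \<subseteq> Collect (pwf L) \<and>
     (\<forall>(P, a)\<in>rls L. finite P \<and> P \<subseteq> Collect (pwf L) \<and> pwf L a) \<and>
     expands_mtl L \<and> congruence_property L \<and> local_deduction_theorem L"


section \<open>Predicate languages\<close>

datatype 'f trm = Var nat | Fun 'f "'f trm list"

datatype ('c, 'f, 'p) fm =
    Pred 'p "'f trm list"
  | Zero
  | One
  | And "('c, 'f, 'p) fm" "('c, 'f, 'p) fm"  (infixr \<open>\<^bold>\<and>\<close> 55)
  | Or "('c, 'f, 'p) fm" "('c, 'f, 'p) fm"  (infixr \<open>\<^bold>\<or>\<close> 53)
  | Amp "('c, 'f, 'p) fm" "('c, 'f, 'p) fm"  (infixr \<open>\<^bold>&\<close> 60)
  | Imp "('c, 'f, 'p) fm" "('c, 'f, 'p) fm"  (infixr \<open>\<^bold>\<rightarrow>\<close> 52)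
  | Conn 'c "('c, 'f, 'p) fm list"
  | Forall nat "('c, 'f, 'p) fm"
  | Exists nat "('c, 'f, 'p) fm"

abbreviation Iff :: "('c, 'f, 'p) fm \<Rightarrow> ('c, 'f, 'p) fm \<Rightarrow> ('c, 'f, 'p) fm"
    (infix \<open>\<^bold>\<leftrightarrow>\<close> 51) where
  "\<phi> \<^bold>\<leftrightarrow> \<psi> \<equiv> (\<phi> \<^bold>\<rightarrow> \<psi>) \<^bold>& (\<psi> \<^bold>\<rightarrow> \<phi>)"

text \<open>\<open>sim\<close> is the similarity symbol; it is one of the predicate symbols.\<close>

record ('f, 'p) lang =
  fsyms :: "'f set"
  f_ar :: "'f \<Rightarrow> nat"
  psyms :: "'p set"
  p_ar :: "'p \<Rightarrow> nat"
  sim :: 'p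

definition predicate_language :: "('f, 'p) lang \<Rightarrow> bool" where
  "predicate_language G \<longleftrightarrow> sim G \<in> psyms G \<and> p_ar G (sim G) = 2"

fun twf :: "('f, 'p) lang \<Rightarrow> 'f trm \<Rightarrow> bool" where
  "twf G (Var x) = True"
| "twf G (Fun f ts) = (f \<in> fsyms G \<and> length ts = f_ar G f \<and> (\<forall>t\<in>set ts. twf G t))"

fun fwf :: "'c plogic \<Rightarrow> ('f, 'p) lang \<Rightarrow> ('c, 'f, 'p) fm \<Rightarrow> bool" where
  "fwf L G (Pred p ts) = (p \<in> psyms G \<and> length ts = p_ar G p \<and> (\<forall>t\<in>set ts. twf G t))"
| "fwf L G Zero = True"
| "fwf L G One = True"
| "fwf L G (\<phi> \<^bold>\<and> \<psi>) = (fwf L G \<phi> \<and> fwf L G \<psi>)"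
| "fwf L G (\<phi> \<^bold>\<or> \<psi>) = (fwf L G \<phi> \<and> fwf L G \<psi>)"
| "fwf L G (\<phi> \<^bold>& \<psi>) = (fwf L G \<phi> \<and> fwf L G \<psi>)"
| "fwf L G (\<phi> \<^bold>\<rightarrow> \<psi>) = (fwf L G \<phi> \<and> fwf L G \<psi>)"
| "fwf L G (Conn c \<phi>s) = (c \<in> conns L \<and> length \<phi>s = conn_ar L c \<and> (\<forall>\<phi>\<in>set \<phi>s. fwf L G \<phi>))"
| "fwf L G (Forall x \<phi>) = fwf L G \<phi>"
| "fwf L G (Exists x \<phi>) = fwf L G \<phi>"

abbreviation formulas :: "'c plogic \<Rightarrow> ('f, 'p) lang \<Rightarrow> ('c, 'f, 'p) fm set" where
  "formulas L G \<equiv> Collect (fwf L G)"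

abbreviation terms :: "('f, 'p) lang \<Rightarrow> 'f trm set" where
  "terms G \<equiv> Collect (twf G)"

fun tvars :: "'f trm \<Rightarrow> nat set" where
  "tvars (Var x) = {x}"
| "tvars (Fun f ts) = (\<Union>t\<in>set ts. tvars t)"

fun fvars :: "('c, 'f, 'p) fm \<Rightarrow> nat set" where
  "fvars (Pred p ts) = (\<Union>t\<in>set ts. tvars t)"
| "fvars Zero = {}"
| "fvars One = {}"
| "fvars (\<phi> \<^bold>\<and> \<psi>) = fvars \<phi> \<union> fvars \<psi>"
| "fvars (\<phi> \<^bold>\<or> \<psi>) = fvars \<phi> \<union> fvars \<psi>"
| "fvars (\<phi> \<^bold>& \<psi>) = fvars \<phi> \<union> fvars \<psi>"
| "fvars (\<phi> \<^bold>\<rightarrow> \<psi>) = fvars \<phi> \<union> fvars \<psi>"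
| "fvars (Conn c \<phi>s) = (\<Union>\<phi>\<in>set \<phi>s. fvars \<phi>)"
| "fvars (Forall x \<phi>) = fvars \<phi> - {x}"
| "fvars (Exists x \<phi>) = fvars \<phi> - {x}"

fun tsubst :: "nat \<Rightarrow> 'f trm \<Rightarrow> 'f trm \<Rightarrow> 'f trm" where
  "tsubst x t (Var y) = (if y = x then t else Var y)"
| "tsubst x t (Fun f ts) = Fun f (map (tsubst x t) ts)"

text \<open>
  \<open>subst x t \<phi>\<close> replaces the free occurrences of \<open>x\<close> in \<open>\<phi>\<close> by \<open>t\<close> without renaming bound
  variables; \<open>substitutable t x \<phi>\<close> excludes capture.
\<close>

fun subst :: "nat \<Rightarrow> 'f trm \<Rightarrow> ('c, 'f, 'p) fm \<Rightarrow> ('c, 'f, 'p) fm" where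
  "subst x t (Pred p ts) = Pred p (map (tsubst x t) ts)"
| "subst x t Zero = Zero"
| "subst x t One = One"
| "subst x t (\<phi> \<^bold>\<and> \<psi>) = subst x t \<phi> \<^bold>\<and> subst x t \<psi>"
| "subst x t (\<phi> \<^bold>\<or> \<psi>) = subst x t \<phi> \<^bold>\<or> subst x t \<psi>"
| "subst x t (\<phi> \<^bold>& \<psi>) = subst x t \<phi> \<^bold>& subst x t \<psi>"
| "subst x t (\<phi> \<^bold>\<rightarrow> \<psi>) = subst x t \<phi> \<^bold>\<rightarrow> subst x t \<psi>"
| "subst x t (Conn c \<phi>s) = Conn c (map (subst x t) \<phi>s)"
| "subst x t (Forall y \<phi>) = Forall y (if y = x then \<phi> else subst x t \<phi>)"
| "subst x t (Exists y \<phi>) = Exists y (if y = x then \<phi> else subst x t \<phi>)"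

fun substitutable :: "'f trm \<Rightarrow> nat \<Rightarrow> ('c, 'f, 'p) fm \<Rightarrow> bool" where
  "substitutable t x (Pred p ts) = True"
| "substitutable t x Zero = True"
| "substitutable t x One = True"
| "substitutable t x (\<phi> \<^bold>\<and> \<psi>) = (substitutable t x \<phi> \<and> substitutable t x \<psi>)"
| "substitutable t x (\<phi> \<^bold>\<or> \<psi>) = (substitutable t x \<phi> \<and> substitutable t x \<psi>)"
| "substitutable t x (\<phi> \<^bold>& \<psi>) = (substitutable t x \<phi> \<and> substitutable t x \<psi>)"
| "substitutable t x (\<phi> \<^bold>\<rightarrow> \<psi>) = (substitutable t x \<phi> \<and> substitutable t x \<psi>)"
| "substitutable t x (Conn c \<phi>s) = (\<forall>\<phi>\<in>set \<phi>s. substitutable t x \<phi>)"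
| "substitutable t x (Forall y \<phi>) =
     (x \<notin> fvars (Forall y \<phi>) \<or> (y \<notin> tvars t \<and> substitutable t x \<phi>))"
| "substitutable t x (Exists y \<phi>) =
     (x \<notin> fvars (Exists y \<phi>) \<or> (y \<notin> tvars t \<and> substitutable t x \<phi>))"

fun inst :: "(nat \<Rightarrow> ('c, 'f, 'p) fm) \<Rightarrow> 'c pfm \<Rightarrow> ('c, 'f, 'p) fm" where
  "inst s (PVar i) = s i"
| "inst s PZero = Zero"
| "inst s POne = One"
| "inst s (a \<and>\<^sub>p b) = inst s a \<^bold>\<and> inst s b"
| "inst s (a \<or>\<^sub>p b) = inst s a \<^bold>\<or> inst s b"
| "inst s (a &\<^sub>p b) = inst s a \<^bold>& inst s b"
| "inst s (a \<rightarrow>\<^sub>p b) = inst s a \<^bold>\<rightarrow> inst s b"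
| "inst s (PConn c as) = Conn c (map (inst s) as)"


section \<open>The predicate logic with similarity\<close>

abbreviation Sim :: "('f, 'p) lang \<Rightarrow> 'f trm \<Rightarrow> 'f trm \<Rightarrow> ('c, 'f, 'p) fm" where
  "Sim G t u \<equiv> Pred (sim G) [t, u]"

abbreviation Foralls :: "nat list \<Rightarrow> ('c, 'f, 'p) fm \<Rightarrow> ('c, 'f, 'p) fm" where
  "Foralls xs \<phi> \<equiv> foldr Forall xs \<phi>"

text \<open>\<open>amp_imp [\<phi>\<^sub>1, \<dots>, \<phi>\<^sub>n] \<psi>\<close> is \<open>\<phi>\<^sub>1 & \<dots> & \<phi>\<^sub>n \<rightarrow> \<psi>\<close>, and just \<open>\<psi>\<close> if \<open>n = 0\<close>.\<close>

fun amps :: "('c, 'f, 'p) fm list \<Rightarrow> ('c, 'f, 'p) fm" where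
  "amps [] = One"
| "amps [\<phi>] = \<phi>"
| "amps (\<phi> # \<psi> # \<chi>s) = \<phi> \<^bold>& amps (\<psi> # \<chi>s)"

definition amp_imp :: "('c, 'f, 'p) fm list \<Rightarrow> ('c, 'f, 'p) fm \<Rightarrow> ('c, 'f, 'p) fm" where
  "amp_imp \<phi>s \<psi> = (if \<phi>s = [] then \<psi> else amps \<phi>s \<^bold>\<rightarrow> \<psi>)"

definition similar_args ::
    "('f, 'p) lang \<Rightarrow> nat list \<Rightarrow> nat list \<Rightarrow> ('c, 'f, 'p) fm list" where
  "similar_args G xs ys = map2 (\<lambda>x y. Sim G (Var x) (Var y)) xs ys"

inductive_set similarity_axioms :: "('f, 'p) lang \<Rightarrow> ('c, 'f, 'p) fm set" for G where
  refl: "Forall x (Sim G (Var x) (Var x)) \<in> similarity_axioms G"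
| sym: "distinct [x, y] \<Longrightarrow>
    Forall x (Forall y (Sim G (Var x) (Var y) \<^bold>\<rightarrow> Sim G (Var y) (Var x)))
      \<in> similarity_axioms G"
| trans: "distinct [x, y, z] \<Longrightarrow>
    Forall x (Forall y (Forall z
      (Sim G (Var x) (Var y) \<^bold>& Sim G (Var y) (Var z) \<^bold>\<rightarrow> Sim G (Var x) (Var z))))
      \<in> similarity_axioms G"
| func: "f \<in> fsyms G \<Longrightarrow> length xs = f_ar G f \<Longrightarrow> length ys = f_ar G f \<Longrightarrow> distinct (xs @ ys) \<Longrightarrow>
    Foralls (xs @ ys)
      (amp_imp (similar_args G xs ys) (Sim G (Fun f (map Var xs)) (Fun f (map Var ys))))
      \<in> similarity_axioms G"
| pred: "p \<in> psyms G \<Longrightarrow> length xs = p_ar G p \<Longrightarrow> length ys = p_ar G p \<Longrightarrow> distinct (xs @ ys) \<Longrightarrow>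
    Foralls (xs @ ys)
      (amp_imp (similar_args G xs ys) (Pred p (map Var xs) \<^bold>\<leftrightarrow> Pred p (map Var ys)))
      \<in> similarity_axioms G"

text \<open>
  Generalization is unrestricted: a variable that occurs free in a formula of \<open>\<Phi>\<close> may be
  generalized.
\<close>

inductive prov :: "'c plogic \<Rightarrow> ('f, 'p) lang \<Rightarrow> ('c, 'f, 'p) fm set \<Rightarrow> ('c, 'f, 'p) fm \<Rightarrow> bool"
    for L G \<Phi> where
  hyp: "\<phi> \<in> \<Phi> \<Longrightarrow> prov L G \<Phi> \<phi>"
| ax: "a \<in> axs L \<Longrightarrow> \<forall>i. fwf L G (s i) \<Longrightarrow> prov L G \<Phi> (inst s a)"
| similarity: "\<phi> \<in> similarity_axioms G \<Longrightarrow> prov L G \<Phi> \<phi>"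
| forall1: "fwf L G \<phi> \<Longrightarrow> twf G t \<Longrightarrow> substitutable t x \<phi> \<Longrightarrow>
    prov L G \<Phi> (Forall x \<phi> \<^bold>\<rightarrow> subst x t \<phi>)"
| exists1: "fwf L G \<phi> \<Longrightarrow> twf G t \<Longrightarrow> substitutable t x \<phi> \<Longrightarrow>
    prov L G \<Phi> (subst x t \<phi> \<^bold>\<rightarrow> Exists x \<phi>)"
| forall2: "fwf L G \<xi> \<Longrightarrow> fwf L G \<phi> \<Longrightarrow> x \<notin> fvars \<xi> \<Longrightarrow>
    prov L G \<Phi> (Forall x (\<xi> \<^bold>\<rightarrow> \<phi>) \<^bold>\<rightarrow> \<xi> \<^bold>\<rightarrow> Forall x \<phi>)"
| exists2: "fwf L G \<xi> \<Longrightarrow> fwf L G \<phi> \<Longrightarrow> x \<notin> fvars \<xi> \<Longrightarrow>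
    prov L G \<Phi> (Forall x (\<phi> \<^bold>\<rightarrow> \<xi>) \<^bold>\<rightarrow> Exists x \<phi> \<^bold>\<rightarrow> \<xi>)"
| rule: "(P, a) \<in> rls L \<Longrightarrow> \<forall>i. fwf L G (s i) \<Longrightarrow> (\<And>b. b \<in> P \<Longrightarrow> prov L G \<Phi> (inst s b)) \<Longrightarrow>
    prov L G \<Phi> (inst s a)"
| gen: "prov L G \<Phi> \<phi> \<Longrightarrow> prov L G \<Phi> (Forall x \<phi>)"

definition consistent :: "'c plogic \<Rightarrow> ('f, 'p) lang \<Rightarrow> ('c, 'f, 'p) fm set \<Rightarrow> bool" where
  "consistent L G \<Phi> \<longleftrightarrow> \<not> prov L G \<Phi> Zero"


section \<open>Semantics\<close>

record ('c, 'a) alg =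
  meet :: "'a \<Rightarrow> 'a \<Rightarrow> 'a"
  join :: "'a \<Rightarrow> 'a \<Rightarrow> 'a"
  mult :: "'a \<Rightarrow> 'a \<Rightarrow> 'a"
  resid :: "'a \<Rightarrow> 'a \<Rightarrow> 'a"
  bottom :: 'a
  unit :: 'a
  conn :: "'c \<Rightarrow> 'a list \<Rightarrow> 'a"

definition leq :: "('c, 'a) alg \<Rightarrow> 'a \<Rightarrow> 'a \<Rightarrow> bool" where
  "leq A a b \<longleftrightarrow> meet A a b = a"

text \<open>Infima and suprema with respect to the lattice order; unspecified where they do not exist.\<close>

definition infimum :: "('c, 'a) alg \<Rightarrow> 'a set \<Rightarrow> 'a" where
  "infimum A S =
     (THE a. (\<forall>s\<in>S. leq A a s) \<and> (\<forall>b. (\<forall>s\<in>S. leq A b s) \<longrightarrow> leq A b a))"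

definition supremum :: "('c, 'a) alg \<Rightarrow> 'a set \<Rightarrow> 'a" where
  "supremum A S =
     (THE a. (\<forall>s\<in>S. leq A s a) \<and> (\<forall>b. (\<forall>s\<in>S. leq A s b) \<longrightarrow> leq A a b))"

record ('f, 'p, 'm, 'a) struct =
  univ :: "'m set"
  fun_of :: "'f \<Rightarrow> 'm list \<Rightarrow> 'm"
  pred_of :: "'p \<Rightarrow> 'm list \<Rightarrow> 'a"

fun tval :: "('f, 'p, 'm, 'a) struct \<Rightarrow> (nat \<Rightarrow> 'm) \<Rightarrow> 'f trm \<Rightarrow> 'm" where
  "tval M v (Var x) = v x"
| "tval M v (Fun f ts) = fun_of M f (map (tval M v) ts)"

fun fval :: "('c, 'a) alg \<Rightarrow> ('f, 'p, 'm, 'a) struct \<Rightarrow> (nat \<Rightarrow> 'm) \<Rightarrow> ('c, 'f, 'p) fm \<Rightarrow> 'a" where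
  "fval A M v (Pred p ts) = pred_of M p (map (tval M v) ts)"
| "fval A M v Zero = bottom A"
| "fval A M v One = unit A"
| "fval A M v (\<phi> \<^bold>\<and> \<psi>) = meet A (fval A M v \<phi>) (fval A M v \<psi>)"
| "fval A M v (\<phi> \<^bold>\<or> \<psi>) = join A (fval A M v \<phi>) (fval A M v \<psi>)"
| "fval A M v (\<phi> \<^bold>& \<psi>) = mult A (fval A M v \<phi>) (fval A M v \<psi>)"
| "fval A M v (\<phi> \<^bold>\<rightarrow> \<psi>) = resid A (fval A M v \<phi>) (fval A M v \<psi>)"
| "fval A M v (Conn c \<phi>s) = conn A c (map (fval A M v) \<phi>s)"
| "fval A M v (Forall x \<phi>) = infimum A ((\<lambda>m. fval A M (v(x := m)) \<phi>) ` univ M)"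
| "fval A M v (Exists x \<phi>) = supremum A ((\<lambda>m. fval A M (v(x := m)) \<phi>) ` univ M)"

text \<open>
  The two-valued Boolean algebra. The parameter \<open>k\<close> interprets the connectives that \<open>L\<close> adds to
  those of MTL, which the Boolean operations do not determine.
\<close>

definition two_alg :: "('c \<Rightarrow> bool list \<Rightarrow> bool) \<Rightarrow> ('c, bool) alg" where
  "two_alg k = \<lparr>meet = (\<and>), join = (\<or>), mult = (\<and>), resid = (\<longrightarrow>),
     bottom = False, unit = True, conn = k\<rparr>"


section \<open>The term structure\<close>

definition tclass ::
    "'c plogic \<Rightarrow> ('f, 'p) lang \<Rightarrow> ('c, 'f, 'p) fm set \<Rightarrow> 'f trm \<Rightarrow> 'f trm set" where
  "tclass L G \<Phi> t = {u \<in> terms G. prov L G \<Phi> (Sim G t u)}"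

definition term_struct ::
    "'c plogic \<Rightarrow> ('f, 'p) lang \<Rightarrow> ('c, 'f, 'p) fm set \<Rightarrow> ('f, 'p, 'f trm set, bool) struct" where
  "term_struct L G \<Phi> =
     \<lparr>univ = tclass L G \<Phi> ` terms G,
      fun_of = (\<lambda>f ds. THE d. \<exists>ts. set ts \<subseteq> terms G \<and> ds = map (tclass L G \<Phi>) ts \<and>
        d = tclass L G \<Phi> (Fun f ts)),
      pred_of = (\<lambda>p ds. \<exists>ts. set ts \<subseteq> terms G \<and> ds = map (tclass L G \<Phi>) ts \<and>
        prov L G \<Phi> (Pred p ts))\<rparr>"

definition canonical_eval ::
    "'c plogic \<Rightarrow> ('f, 'p) lang \<Rightarrow> ('c, 'f, 'p) fm set \<Rightarrow> nat \<Rightarrow> 'f trm set" where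
  "canonical_eval L G \<Phi> x = tclass L G \<Phi> (Var x)"


section \<open>Horn clauses\<close>

text \<open>The truth constants count as atomic formulas.\<close>

inductive atomic :: "('c, 'f, 'p) fm \<Rightarrow> bool" where
  "atomic (Pred p ts)"
| "atomic Zero"
| "atomic One"

text \<open>
  \<open>conj_of cj S\<close> holds for the conjunctions of one or more formulas in \<open>S\<close>, in any
  bracketing. The conjunction \<open>cj\<close> is \<open>Amp\<close> for Horn clauses and \<open>And\<close> for w-Horn clauses.
\<close>

inductive conj_of :: "(('c, 'f, 'p) fm \<Rightarrow> ('c, 'f, 'p) fm \<Rightarrow> ('c, 'f, 'p) fm) \<Rightarrow>
    (('c, 'f, 'p) fm \<Rightarrow> bool) \<Rightarrow> ('c, 'f, 'p) fm \<Rightarrow> bool" for cj S where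
  "S \<phi> \<Longrightarrow> conj_of cj S \<phi>"
| "conj_of cj S \<phi> \<Longrightarrow> conj_of cj S \<psi> \<Longrightarrow> conj_of cj S (cj \<phi> \<psi>)"

inductive basic_horn :: "(('c, 'f, 'p) fm \<Rightarrow> ('c, 'f, 'p) fm \<Rightarrow> ('c, 'f, 'p) fm) \<Rightarrow>
    ('c, 'f, 'p) fm \<Rightarrow> bool" for cj where
  "atomic \<beta> \<Longrightarrow> basic_horn cj \<beta>"
| "conj_of cj atomic \<alpha> \<Longrightarrow> atomic \<beta> \<Longrightarrow> basic_horn cj (\<alpha> \<^bold>\<rightarrow> \<beta>)"

definition horn :: "(('c, 'f, 'p) fm \<Rightarrow> ('c, 'f, 'p) fm \<Rightarrow> ('c, 'f, 'p) fm) \<Rightarrow>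
    ('c, 'f, 'p) fm \<Rightarrow> bool" where
  "horn cj \<phi> \<longleftrightarrow> (\<exists>xs \<gamma>. \<phi> = Foralls xs \<gamma> \<and> conj_of cj (basic_horn cj) \<gamma>)"

abbreviation horn_clause :: "('c, 'f, 'p) fm \<Rightarrow> bool" where
  "horn_clause \<equiv> horn Amp"

abbreviation w_horn_clause :: "('c, 'f, 'p) fm \<Rightarrow> bool" where
  "w_horn_clause \<equiv> horn And"

end

theory Submission
  imports Defs
begin

text \<open>
  Since generalization is unrestricted, provability from \<open>\<Phi>\<close> is closed under substituting terms for
  the variables of a quantifier-free formula. The elements of the term structure are classes of
  terms, so a universally quantified clause reduces to the provable instances of its matrix. For
  these the argument is that of classical logic: an atomic formula is true exactly if its instance
  is provable (for \<open>0\<close> by consistency), MTL derives a conjunction of either kind from its conjuncts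
  and conversely, and modus ponens handles the implications.
\<close>

section \<open>Simultaneous substitution\<close>

fun tsub :: "(nat \<Rightarrow> 'f trm) \<Rightarrow> 'f trm \<Rightarrow> 'f trm" where
  "tsub \<sigma> (Var x) = \<sigma> x"
| "tsub \<sigma> (Fun f ts) = Fun f (map (tsub \<sigma>) ts)"

text \<open>Like \<open>subst\<close>, this does not rename bound variables.\<close>

fun fsub :: "(nat \<Rightarrow> 'f trm) \<Rightarrow> ('c, 'f, 'p) fm \<Rightarrow> ('c, 'f, 'p) fm" where
  "fsub \<sigma> (Pred p ts) = Pred p (map (tsub \<sigma>) ts)"
| "fsub \<sigma> Zero = Zero"
| "fsub \<sigma> One = One"
| "fsub \<sigma> (\<phi> \<^bold>\<and> \<psi>) = fsub \<sigma> \<phi> \<^bold>\<and> fsub \<sigma> \<psi>"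
| "fsub \<sigma> (\<phi> \<^bold>\<or> \<psi>) = fsub \<sigma> \<phi> \<^bold>\<or> fsub \<sigma> \<psi>"
| "fsub \<sigma> (\<phi> \<^bold>& \<psi>) = fsub \<sigma> \<phi> \<^bold>& fsub \<sigma> \<psi>"
| "fsub \<sigma> (\<phi> \<^bold>\<rightarrow> \<psi>) = fsub \<sigma> \<phi> \<^bold>\<rightarrow> fsub \<sigma> \<psi>"
| "fsub \<sigma> (Conn c \<phi>s) = Conn c (map (fsub \<sigma>) \<phi>s)"
| "fsub \<sigma> (Forall x \<phi>) = Forall x (fsub (\<sigma>(x := Var x)) \<phi>)"
| "fsub \<sigma> (Exists x \<phi>) = Exists x (fsub (\<sigma>(x := Var x)) \<phi>)"

fun qfree :: "('c, 'f, 'p) fm \<Rightarrow> bool" where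
  "qfree (Pred p ts) = True"
| "qfree Zero = True"
| "qfree One = True"
| "qfree (\<phi> \<^bold>\<and> \<psi>) = (qfree \<phi> \<and> qfree \<psi>)"
| "qfree (\<phi> \<^bold>\<or> \<psi>) = (qfree \<phi> \<and> qfree \<psi>)"
| "qfree (\<phi> \<^bold>& \<psi>) = (qfree \<phi> \<and> qfree \<psi>)"
| "qfree (\<phi> \<^bold>\<rightarrow> \<psi>) = (qfree \<phi> \<and> qfree \<psi>)"
| "qfree (Conn c \<phi>s) = (\<forall>\<phi>\<in>set \<phi>s. qfree \<phi>)"
| "qfree (Forall x \<phi>) = False"
| "qfree (Exists x \<phi>) = False"

section \<open>Composition and invariance of substitutions\<close>

lemma tsub_Var [simp]: "tsub Var t = t"
  by (induction t) (auto intro: map_idI)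

lemma tsub_cong: "(\<And>x. x \<in> tvars t \<Longrightarrow> \<sigma> x = \<tau> x) \<Longrightarrow> tsub \<sigma> t = tsub \<tau> t"
  by (induction t) auto

lemma tsubst_tsub: "tsubst x u (tsub \<sigma> t) = tsub (\<lambda>y. tsubst x u (\<sigma> y)) t"
  by (induction t) auto

lemma tsubst_idle: "x \<notin> tvars t \<Longrightarrow> tsubst x u t = t"
  by (induction t) (auto intro: map_idI)

lemma twf_tsub: "twf G t \<Longrightarrow> (\<And>x. twf G (\<sigma> x)) \<Longrightarrow> twf G (tsub \<sigma> t)"
  by (induction t) auto

lemma finite_tvars [simp]: "finite (tvars t)"
  by (induction t) auto

lemma fsub_Var: "qfree \<phi> \<Longrightarrow> fsub Var \<phi> = \<phi>"
  by (induction \<phi>) (auto intro: map_idI)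

lemma fsub_cong: "qfree \<phi> \<Longrightarrow> (\<And>x. x \<in> fvars \<phi> \<Longrightarrow> \<sigma> x = \<tau> x) \<Longrightarrow> fsub \<sigma> \<phi> = fsub \<tau> \<phi>"
  by (induction \<phi>) (auto intro: tsub_cong)

text \<open>Without quantifiers there is neither capture nor shadowing, so a single substitution
  performed after a simultaneous one merges into it.\<close>

lemma subst_fsub: "qfree \<phi> \<Longrightarrow> subst x u (fsub \<sigma> \<phi>) = fsub (\<lambda>y. tsubst x u (\<sigma> y)) \<phi>"
  by (induction \<phi>) (auto simp: tsubst_tsub)

lemma fwf_fsub: "fwf L G \<phi> \<Longrightarrow> (\<And>x. twf G (\<sigma> x)) \<Longrightarrow> fwf L G (fsub \<sigma> \<phi>)"
  by (induction \<phi> arbitrary: \<sigma>) (auto simp: twf_tsub)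

lemma qfree_fsub: "qfree \<phi> \<Longrightarrow> qfree (fsub \<sigma> \<phi>)"
  by (induction \<phi>) auto

lemma finite_fvars [simp]: "finite (fvars \<phi>)"
  by (induction \<phi>) auto

lemma substitutable_qfree: "qfree \<phi> \<Longrightarrow> substitutable t x \<phi>"
  by (induction \<phi>) auto

text \<open>A binder of \<open>x\<close> hides \<open>x\<close>, and no other binder occurs in
  \<open>Var x\<close>. Hence a quantifier can always be instantiated with its own variable.\<close>

lemma substitutable_Var: "substitutable (Var x) x \<phi>"
  by (induction \<phi>) auto

lemma tsubst_Var: "tsubst x (Var x) t = t"
  by (induction t) (auto intro: map_idI)

lemma subst_Var: "subst x (Var x) \<phi> = \<phi>"
  by (induction \<phi>) (auto simp: tsubst_Var intro: map_idI)

lemma fwf_Foralls [simp]: "fwf L G (Foralls xs \<phi>) = fwf L G \<phi>"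
  by (induction xs) auto


section \<open>Derivations\<close>

lemma inst_psubst: "inst s (psubst r a) = inst (\<lambda>i. inst s (r i)) a"
  by (induction r a rule: psubst.induct) auto

lemma psubst_PVar: "psubst PVar a = a"
  by (induction a) (auto intro: map_idI)

lemma fwf_inst: "pwf L a \<Longrightarrow> (\<And>i. fwf L G (s i)) \<Longrightarrow> fwf L G (inst s a)"
  by (induction a) auto

text \<open>The derivation is translated step by step: instantiating a propositional substitution
  instance of an axiom or rule of \<open>L\<close> gives a first-order instance of that same axiom
  or rule.\<close>

lemma prov_inst:
  assumes "pprov L T a" and "\<And>b. b \<in> T \<Longrightarrow> prov L G \<Phi> (inst s b)" and "\<And>i. fwf L G (s i)"
  shows "prov L G \<Phi> (inst s a)"
  using assms(1)
proof induction
  case (hyp a)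
  then show ?case by (rule assms(2))
next
  case (ax a r)
  then show ?case
    unfolding inst_psubst by (intro prov.ax) (auto intro!: fwf_inst assms(3))
next
  case (rule P a r)
  show ?case
    unfolding inst_psubst
  proof (rule prov.rule[OF rule.hyps(1)])
    show "\<forall>i. fwf L G (inst s (r i))"
      using rule.hyps(2) by (auto intro!: fwf_inst assms(3))
    show "prov L G \<Phi> (inst (\<lambda>i. inst s (r i)) b)" if "b \<in> P" for b
      using rule.IH[OF that] by (simp add: inst_psubst)
  qed
qed

locale theory_over_core_fuzzy_logic =
  fixes L :: "'c plogic" and G :: "('f, 'p) lang" and \<Phi> :: "('c, 'f, 'p) fm set"
  assumes core: "core_fuzzy_logic L" and lang: "predicate_language G"
begin

abbreviation derivable :: "('c, 'f, 'p) fm \<Rightarrow> bool"  (\<open>\<turnstile> _\<close> [50] 50) where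
  "\<turnstile> \<phi> \<equiv> prov L G \<Phi> \<phi>"

abbreviation wf_fm :: "('c, 'f, 'p) fm \<Rightarrow> bool" where
  "wf_fm \<equiv> fwf L G"

text \<open>The presentation of \<open>L\<close> may lack the axioms and the rule of MTL. An MTL
  derivation is therefore first turned into one in \<open>L\<close> by \<open>expands_mtl\<close>
  and then instantiated.\<close>

lemma mtl_consequence:
  assumes "pprov (L\<lparr>axs := mtl_axioms, rls := mtl_rules\<rparr>) T a" and "T \<subseteq> Collect (pwf L)"
    and "\<And>b. b \<in> T \<Longrightarrow> \<turnstile> inst s b" and "\<And>i. wf_fm (s i)"
  shows "\<turnstile> inst s a"
proof (rule prov_inst)
  show "pprov L T a"
    using core assms(1,2) by (auto simp: core_fuzzy_logic_def expands_mtl_def)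
qed (use assms in auto)

lemma mtl_axiom_instance:
  assumes "a \<in> mtl_axioms" and "\<And>i. wf_fm (s i)"
  shows "\<turnstile> inst s a"
proof (rule mtl_consequence[where T = "{}"])
  show "pprov (L\<lparr>axs := mtl_axioms, rls := mtl_rules\<rparr>) {} a"
    using pprov.ax[of a "L\<lparr>axs := mtl_axioms, rls := mtl_rules\<rparr>" PVar "{}"] assms(1)
    by (simp add: psubst_PVar)
qed (use assms in auto)

lemma modus_ponens:
  assumes "\<turnstile> \<phi>" and "\<turnstile> \<phi> \<^bold>\<rightarrow> \<psi>" and "wf_fm \<phi>" and "wf_fm \<psi>"
  shows "\<turnstile> \<psi>"
proof -
  let ?T = "{PVar 0, PVar 0 \<rightarrow>\<^sub>p PVar 1} :: 'c pfm set"
  let ?s = "\<lambda>i::nat. if i = 0 then \<phi> else \<psi>"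
  \<comment> \<open>Modus ponens is the only rule of MTL; here it is applied to the schematic
    premises themselves, under the identity substitution.\<close>
  have "pprov (L\<lparr>axs := mtl_axioms, rls := mtl_rules\<rparr>) ?T (psubst PVar (PVar 1))"
    by (rule pprov.rule[where P = ?T]) (auto simp: mtl_rules_def intro: pprov.hyp)
  then have "pprov (L\<lparr>axs := mtl_axioms, rls := mtl_rules\<rparr>) ?T (PVar 1)"
    by simp
  then have "\<turnstile> inst ?s (PVar 1)"
    by (rule mtl_consequence[where T = ?T]) (use assms in auto)
  then show ?thesis by simp
qed

section \<open>Derived rules for implication and the two conjunctions\<close>

lemma
  assumes "wf_fm \<phi>" "wf_fm \<psi>"
  shows mtl_amp_left: "\<turnstile> \<phi> \<^bold>& \<psi> \<^bold>\<rightarrow> \<phi>"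
    and mtl_amp_comm: "\<turnstile> \<phi> \<^bold>& \<psi> \<^bold>\<rightarrow> \<psi> \<^bold>& \<phi>"
    and mtl_and_left: "\<turnstile> \<phi> \<^bold>\<and> \<psi> \<^bold>\<rightarrow> \<phi>"
    and mtl_and_comm: "\<turnstile> \<phi> \<^bold>\<and> \<psi> \<^bold>\<rightarrow> \<psi> \<^bold>\<and> \<phi>"
    and mtl_amp_imp_and: "\<turnstile> \<phi> \<^bold>& (\<phi> \<^bold>\<rightarrow> \<psi>) \<^bold>\<rightarrow> \<phi> \<^bold>\<and> \<psi>"
proof -
  let ?s = "\<lambda>i::nat. if i = 0 then \<phi> else \<psi>"
  let ?p = "PVar 0 :: 'c pfm" and ?q = "PVar 1 :: 'c pfm"
  have *: "\<turnstile> inst ?s a" if "a \<in> mtl_axioms" for a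
    by (rule mtl_axiom_instance) (use that assms in auto)
  show "\<turnstile> \<phi> \<^bold>& \<psi> \<^bold>\<rightarrow> \<phi>"
    using *[of "?p &\<^sub>p ?q \<rightarrow>\<^sub>p ?p"] by (simp add: mtl_axioms_def Let_def)
  show "\<turnstile> \<phi> \<^bold>& \<psi> \<^bold>\<rightarrow> \<psi> \<^bold>& \<phi>"
    using *[of "?p &\<^sub>p ?q \<rightarrow>\<^sub>p ?q &\<^sub>p ?p"] by (simp add: mtl_axioms_def Let_def)
  show "\<turnstile> \<phi> \<^bold>\<and> \<psi> \<^bold>\<rightarrow> \<phi>"
    using *[of "?p \<and>\<^sub>p ?q \<rightarrow>\<^sub>p ?p"] by (simp add: mtl_axioms_def Let_def)
  show "\<turnstile> \<phi> \<^bold>\<and> \<psi> \<^bold>\<rightarrow> \<psi> \<^bold>\<and> \<phi>"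
    using *[of "?p \<and>\<^sub>p ?q \<rightarrow>\<^sub>p ?q \<and>\<^sub>p ?p"] by (simp add: mtl_axioms_def Let_def)
  show "\<turnstile> \<phi> \<^bold>& (\<phi> \<^bold>\<rightarrow> \<psi>) \<^bold>\<rightarrow> \<phi> \<^bold>\<and> \<psi>"
    using *[of "?p &\<^sub>p (?p \<rightarrow>\<^sub>p ?q) \<rightarrow>\<^sub>p ?p \<and>\<^sub>p ?q"] by (simp add: mtl_axioms_def Let_def)
qed

lemma
  assumes "wf_fm \<phi>" "wf_fm \<psi>" "wf_fm \<chi>"
  shows mtl_trans: "\<turnstile> (\<phi> \<^bold>\<rightarrow> \<psi>) \<^bold>\<rightarrow> (\<psi> \<^bold>\<rightarrow> \<chi>) \<^bold>\<rightarrow> \<phi> \<^bold>\<rightarrow> \<chi>"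
    and mtl_residuation: "\<turnstile> (\<phi> \<^bold>& \<psi> \<^bold>\<rightarrow> \<chi>) \<^bold>\<rightarrow> \<phi> \<^bold>\<rightarrow> \<psi> \<^bold>\<rightarrow> \<chi>"
proof -
  let ?s = "\<lambda>i::nat. if i = 0 then \<phi> else if i = 1 then \<psi> else \<chi>"
  let ?p = "PVar 0 :: 'c pfm" and ?q = "PVar 1 :: 'c pfm" and ?r = "PVar 2 :: 'c pfm"
  have *: "\<turnstile> inst ?s a" if "a \<in> mtl_axioms" for a
    by (rule mtl_axiom_instance) (use that assms in auto)
  show "\<turnstile> (\<phi> \<^bold>\<rightarrow> \<psi>) \<^bold>\<rightarrow> (\<psi> \<^bold>\<rightarrow> \<chi>) \<^bold>\<rightarrow> \<phi> \<^bold>\<rightarrow> \<chi>"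
    using *[of "(?p \<rightarrow>\<^sub>p ?q) \<rightarrow>\<^sub>p (?q \<rightarrow>\<^sub>p ?r) \<rightarrow>\<^sub>p ?p \<rightarrow>\<^sub>p ?r"] by (simp add: mtl_axioms_def Let_def)
  show "\<turnstile> (\<phi> \<^bold>& \<psi> \<^bold>\<rightarrow> \<chi>) \<^bold>\<rightarrow> \<phi> \<^bold>\<rightarrow> \<psi> \<^bold>\<rightarrow> \<chi>"
    using *[of "(?p &\<^sub>p ?q \<rightarrow>\<^sub>p ?r) \<rightarrow>\<^sub>p ?p \<rightarrow>\<^sub>p ?q \<rightarrow>\<^sub>p ?r"] by (simp add: mtl_axioms_def Let_def)
qed

lemma derivable_One: "\<turnstile> One"
  using mtl_axiom_instance[of POne "\<lambda>_. One"] by (simp add: mtl_axioms_def Let_def)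

lemma amp_elim:
  assumes "\<turnstile> \<phi> \<^bold>& \<psi>" "wf_fm \<phi>" "wf_fm \<psi>"
  shows "\<turnstile> \<phi>" and "\<turnstile> \<psi>"
proof -
  show "\<turnstile> \<phi>"
    by (rule modus_ponens[OF assms(1) mtl_amp_left]) (use assms in auto)
  have "\<turnstile> \<psi> \<^bold>& \<phi>"
    by (rule modus_ponens[OF assms(1) mtl_amp_comm]) (use assms in auto)
  then show "\<turnstile> \<psi>"
    by (rule modus_ponens[OF _ mtl_amp_left]) (use assms in auto)
qed

lemma and_elim:
  assumes "\<turnstile> \<phi> \<^bold>\<and> \<psi>" "wf_fm \<phi>" "wf_fm \<psi>"
  shows "\<turnstile> \<phi>" and "\<turnstile> \<psi>"
proof -
  show "\<turnstile> \<phi>"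
    by (rule modus_ponens[OF assms(1) mtl_and_left]) (use assms in auto)
  have "\<turnstile> \<psi> \<^bold>\<and> \<phi>"
    by (rule modus_ponens[OF assms(1) mtl_and_comm]) (use assms in auto)
  then show "\<turnstile> \<psi>"
    by (rule modus_ponens[OF _ mtl_and_left]) (use assms in auto)
qed

lemma imp_trans:
  assumes "\<turnstile> \<phi> \<^bold>\<rightarrow> \<psi>" "\<turnstile> \<psi> \<^bold>\<rightarrow> \<chi>" and wf: "wf_fm \<phi>" "wf_fm \<psi>" "wf_fm \<chi>"
  shows "\<turnstile> \<phi> \<^bold>\<rightarrow> \<chi>"
proof -
  have "\<turnstile> (\<psi> \<^bold>\<rightarrow> \<chi>) \<^bold>\<rightarrow> \<phi> \<^bold>\<rightarrow> \<chi>"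
    by (rule modus_ponens[OF assms(1) mtl_trans]) (use wf in auto)
  from modus_ponens[OF assms(2) this] show ?thesis
    using wf by simp
qed

lemma residuation:
  assumes "\<turnstile> \<phi> \<^bold>& \<psi> \<^bold>\<rightarrow> \<chi>" "wf_fm \<phi>" "wf_fm \<psi>" "wf_fm \<chi>"
  shows "\<turnstile> \<phi> \<^bold>\<rightarrow> \<psi> \<^bold>\<rightarrow> \<chi>"
  by (rule modus_ponens[OF assms(1) mtl_residuation]) (use assms in auto)

lemma amp_intro:
  assumes "\<turnstile> \<phi>" "\<turnstile> \<psi>" and wf: "wf_fm \<phi>" "wf_fm \<psi>"
  shows "\<turnstile> \<phi> \<^bold>& \<psi>"
proof -
  \<comment> \<open>The identity is not among the axioms; commuting twice yields it.\<close>
  have "\<turnstile> \<phi> \<^bold>& \<psi> \<^bold>\<rightarrow> \<phi> \<^bold>& \<psi>"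
    by (rule imp_trans[OF mtl_amp_comm mtl_amp_comm]) (use wf in auto)
  then have "\<turnstile> \<phi> \<^bold>\<rightarrow> \<psi> \<^bold>\<rightarrow> \<phi> \<^bold>& \<psi>"
    by (rule residuation) (use wf in auto)
  from modus_ponens[OF assms(1) this] have "\<turnstile> \<psi> \<^bold>\<rightarrow> \<phi> \<^bold>& \<psi>"
    using wf by simp
  from modus_ponens[OF assms(2) this] show ?thesis
    using wf by simp
qed

lemma and_intro:
  assumes "\<turnstile> \<phi>" "\<turnstile> \<psi>" and wf: "wf_fm \<phi>" "wf_fm \<psi>"
  shows "\<turnstile> \<phi> \<^bold>\<and> \<psi>"
proof -
  have "\<turnstile> \<psi> \<^bold>\<rightarrow> \<phi> \<^bold>\<rightarrow> \<psi>"
    by (rule residuation[OF mtl_amp_left]) (use wf in auto)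
  from modus_ponens[OF assms(2) this] have "\<turnstile> \<phi> \<^bold>\<rightarrow> \<psi>"
    using wf by simp
  with assms(1) have "\<turnstile> \<phi> \<^bold>& (\<phi> \<^bold>\<rightarrow> \<psi>)"
    by (rule amp_intro) (use wf in auto)
  then show ?thesis
    by (rule modus_ponens[OF _ mtl_amp_imp_and]) (use wf in auto)
qed

section \<open>Instances of universally quantified formulas\<close>

lemma forall_elim:
  assumes "\<turnstile> Forall x \<phi>" "substitutable t x \<phi>" "wf_fm \<phi>" "twf G t" "wf_fm (subst x t \<phi>)"
  shows "\<turnstile> subst x t \<phi>"
  by (rule modus_ponens[OF assms(1) prov.forall1]) (use assms in auto)

lemma Foralls_elim:
  assumes "\<turnstile> Foralls xs \<phi>" "wf_fm \<phi>"
  shows "\<turnstile> \<phi>"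
  using assms(1)
proof (induction xs)
  case (Cons x xs)
  have "\<turnstile> subst x (Var x) (Foralls xs \<phi>)"
    by (rule forall_elim) (use Cons.prems assms(2) in \<open>auto simp: substitutable_Var subst_Var\<close>)
  then show ?case
    by (auto simp: subst_Var intro: Cons.IH)
qed simp

text \<open>One elementary move: generalize over \<open>x\<close>, which is allowed even if
  \<open>x\<close> is free in \<Phi>, then instantiate with \<open>t\<close>.\<close>

lemma derivable_subst:
  assumes "\<turnstile> fsub \<sigma> \<phi>" "qfree \<phi>" "wf_fm \<phi>" "\<And>y. twf G (\<sigma> y)" "twf G t"
    and "\<And>y. twf G (tsubst x t (\<sigma> y))"
  shows "\<turnstile> fsub (\<lambda>y. tsubst x t (\<sigma> y)) \<phi>"
proof -
  have "\<turnstile> subst x t (fsub \<sigma> \<phi>)"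
    by (rule forall_elim[OF prov.gen])
      (use assms in \<open>auto simp: subst_fsub fwf_fsub substitutable_qfree qfree_fsub\<close>)
  then show ?thesis
    using assms(2) by (simp add: subst_fsub)
qed

lemma derivable_fsub:
  assumes prov: "\<turnstile> \<phi>" and qf: "qfree \<phi>" and wf: "wf_fm \<phi>" and \<sigma>: "\<And>x. twf G (\<sigma> x)"
  shows "\<turnstile> fsub \<sigma> \<phi>"
proof -
  obtain N where N: "\<And>x. x \<in> fvars \<phi> \<union> (\<Union>y\<in>fvars \<phi>. tvars (\<sigma> y)) \<Longrightarrow> x < N"
    using finite_nat_set_iff_bounded[of "fvars \<phi> \<union> (\<Union>y\<in>fvars \<phi>. tvars (\<sigma> y))"] by auto
  \<comment> \<open>All variables are first moved above \<open>N\<close>, so that the terms of \<open>\<sigma>\<close> can then be substituted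
      one after another without interfering.\<close>
  have "\<turnstile> fsub (\<lambda>x. Var (if x < n then x + N else x)) \<phi>" if "n \<le> N" for n
    using that
  proof (induction n)
    case 0
    then show ?case using prov qf by (simp add: fsub_Var)
  next
    case (Suc n)
    have "\<turnstile> fsub (\<lambda>y. tsubst n (Var (n + N)) (Var (if y < n then y + N else y))) \<phi>"
      by (rule derivable_subst) (use Suc qf wf in auto)
    also have "fsub (\<lambda>y. tsubst n (Var (n + N)) (Var (if y < n then y + N else y))) \<phi> =
        fsub (\<lambda>y. Var (if y < Suc n then y + N else y)) \<phi>"
      \<comment> \<open>Since \<open>n < N\<close>, no variable \<open>y + N\<close> produced
        earlier equals \<open>n\<close>, so this round renames \<open>n\<close> only.\<close>
      using Suc.prems qf by (intro fsub_cong) auto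
    finally show ?case .
  qed
  from this[of N] have shifted: "\<turnstile> fsub (\<lambda>x. Var (x + N)) \<phi>"
    using N qf fsub_cong[of \<phi> "\<lambda>x. Var (if x < N then x + N else x)" "\<lambda>x. Var (x + N)"] by simp
  \<comment> \<open>Second phase: the terms of \<sigma> replace the shifted variables
    \<open>N\<close>, \<open>N + 1\<close>, and so on, in this order.\<close>
  have "\<turnstile> fsub (\<lambda>x. if x < n then \<sigma> x else Var (x + N)) \<phi>" for n
  proof (induction n)
    case 0
    show ?case using shifted by simp
  next
    case (Suc n)
    have "\<turnstile> fsub (\<lambda>y. tsubst (n + N) (\<sigma> n) (if y < n then \<sigma> y else Var (y + N))) \<phi>"
    proof (rule derivable_subst[OF Suc qf wf])
      have "twf G (tsubst x (\<sigma> n) t)" if "twf G t" for x t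
        using that \<sigma> by (induction t) auto
      then show "twf G (tsubst (n + N) (\<sigma> n) (if y < n then \<sigma> y else Var (y + N)))" for y
        using \<sigma> by simp
    qed (use \<sigma> in auto)
    also have "fsub (\<lambda>y. tsubst (n + N) (\<sigma> n) (if y < n then \<sigma> y else Var (y + N))) \<phi> =
        fsub (\<lambda>y. if y < Suc n then \<sigma> y else Var (y + N)) \<phi>"
    proof (rule fsub_cong[OF qf])
      fix y assume "y \<in> fvars \<phi>"
      \<comment> \<open>All variables of \<open>\<sigma> y\<close> lie below \<open>N\<close>, so
        terms inserted earlier are left alone.\<close>
      then have "n + N \<notin> tvars (\<sigma> y)"
        using N by fastforce
      then show "tsubst (n + N) (\<sigma> n) (if y < n then \<sigma> y else Var (y + N)) =
          (if y < Suc n then \<sigma> y else Var (y + N))"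
        by (auto simp: tsubst_idle less_Suc_eq)
    qed
    finally show ?case .
  qed
  from this[of N] show ?thesis
    using N qf fsub_cong[of \<phi> "\<lambda>x. if x < N then \<sigma> x else Var (x + N)" \<sigma>] by simp
qed


section \<open>Similarity is a congruence\<close>

lemma sim_symbol [simp]: "sim G \<in> psyms G" "p_ar G (sim G) = 2"
  using lang by (simp_all add: predicate_language_def)

text \<open>The form in which both the similarity axioms and the given clause are used: drop the
  prefix, then substitute in the matrix.\<close>

lemma universal_instance:
  assumes "\<turnstile> Foralls xs \<phi>" "qfree \<phi>" "wf_fm \<phi>" "\<And>x. twf G (\<sigma> x)"
  shows "\<turnstile> fsub \<sigma> \<phi>"
  by (rule derivable_fsub[OF Foralls_elim]) (fact assms)+

lemma Sim_refl:
  assumes "twf G t"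
  shows "\<turnstile> Sim G t t"
  using universal_instance[of "[0]" "Sim G (Var 0) (Var 0)" "\<lambda>_. t"] assms
  by (simp add: prov.similarity similarity_axioms.refl)

lemma Sim_sym:
  assumes "\<turnstile> Sim G t u" and wf: "twf G t" "twf G u"
  shows "\<turnstile> Sim G u t"
proof -
  let ?\<sigma> = "\<lambda>x::nat. if x = 0 then t else u"
  have "\<turnstile> Foralls [0, 1] (Sim G (Var 0) (Var 1) \<^bold>\<rightarrow> Sim G (Var 1) (Var 0))"
    by (simp add: prov.similarity similarity_axioms.sym)
  from universal_instance[OF this, of ?\<sigma>] have "\<turnstile> Sim G t u \<^bold>\<rightarrow> Sim G u t"
    using wf by simp
  from modus_ponens[OF assms(1) this] show ?thesis
    using wf by simp
qed

lemma Sim_trans: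
  assumes "\<turnstile> Sim G t u" "\<turnstile> Sim G u w" and wf: "twf G t" "twf G u" "twf G w"
  shows "\<turnstile> Sim G t w"
proof -
  let ?\<sigma> = "\<lambda>x::nat. if x = 0 then t else if x = 1 then u else w"
  have "\<turnstile> Foralls [0, 1, 2]
      (Sim G (Var 0) (Var 1) \<^bold>& Sim G (Var 1) (Var 2) \<^bold>\<rightarrow> Sim G (Var 0) (Var 2))"
    by (simp add: prov.similarity similarity_axioms.trans)
  from universal_instance[OF this, of ?\<sigma>]
  have "\<turnstile> Sim G t u \<^bold>& Sim G u w \<^bold>\<rightarrow> Sim G t w"
    using wf by simp
  from modus_ponens[OF amp_intro[OF assms(1,2)] this] show ?thesis
    using wf by simp
qed

section \<open>Similarity axioms for function and predicate symbols\<close>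

lemma wf_amps: "(\<And>\<phi>. \<phi> \<in> set \<phi>s \<Longrightarrow> wf_fm \<phi>) \<Longrightarrow> wf_fm (amps \<phi>s)"
  by (induction \<phi>s rule: amps.induct) auto

lemma qfree_amps: "(\<And>\<phi>. \<phi> \<in> set \<phi>s \<Longrightarrow> qfree \<phi>) \<Longrightarrow> qfree (amps \<phi>s)"
  by (induction \<phi>s rule: amps.induct) auto

lemma fsub_amps: "fsub \<sigma> (amps \<phi>s) = amps (map (fsub \<sigma>) \<phi>s)"
  by (induction \<phi>s rule: amps.induct) auto

lemma fsub_amp_imp: "fsub \<sigma> (amp_imp \<phi>s \<psi>) = amp_imp (map (fsub \<sigma>) \<phi>s) (fsub \<sigma> \<psi>)"
  by (simp add: amp_imp_def fsub_amps)

lemma derivable_amps: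
  "(\<And>\<phi>. \<phi> \<in> set \<phi>s \<Longrightarrow> wf_fm \<phi> \<and> \<turnstile> \<phi>) \<Longrightarrow> \<turnstile> amps \<phi>s"
  by (induction \<phi>s rule: amps.induct) (auto intro!: amp_intro derivable_One wf_amps)

lemma amp_imp_elim:
  assumes "\<turnstile> amp_imp \<phi>s \<psi>" "\<And>\<phi>. \<phi> \<in> set \<phi>s \<Longrightarrow> wf_fm \<phi> \<and> \<turnstile> \<phi>" "wf_fm \<psi>"
  shows "\<turnstile> \<psi>"
proof (cases "\<phi>s = []")
  case True
  then show ?thesis using assms(1) by (simp add: amp_imp_def)
next
  case False
  then have "\<turnstile> amps \<phi>s \<^bold>\<rightarrow> \<psi>"
    using assms(1) by (simp add: amp_imp_def)
  from modus_ponens[OF derivable_amps this] show ?thesis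
    using assms(2,3) by (auto intro: wf_amps)
qed

text \<open>Common core of the two congruence axioms. Variables below \<open>n\<close> stand for the
  first argument tuple and the next \<open>n\<close> for the second; \<sigma> sends these blocks to
  \<open>ts\<close> and \<open>us\<close>, so the premises become the assumed similarities.\<close>

lemma similar_instance:
  assumes ax: "\<turnstile> Foralls ([0..<n] @ [n..<n + n]) (amp_imp (similar_args G [0..<n] [n..<n + n]) \<psi>)"
    and \<psi>: "qfree \<psi>" "wf_fm \<psi>"
    and len: "length ts = n" "length us = n"
    and wf: "set ts \<subseteq> terms G" "set us \<subseteq> terms G"
    and sim: "list_all2 (\<lambda>t u. \<turnstile> Sim G t u) ts us"
    and \<sigma>: "\<sigma> = (\<lambda>x. if x < n + n then (ts @ us) ! x else Var x)"
  shows "\<turnstile> fsub \<sigma> \<psi>"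
proof -
  let ?A = "similar_args G [0..<n] [n..<n + n] :: ('c, 'f, 'p) fm list"
  have \<sigma>_wf: "twf G (\<sigma> x)" for x
  proof (cases "x < n + n")
    case True
    then have "(ts @ us) ! x \<in> set (ts @ us)"
      using len by (intro nth_mem) simp
    then show ?thesis
      using True wf by (auto simp: \<sigma>)
  qed (simp add: \<sigma>)
  have A: "qfree \<phi> \<and> wf_fm \<phi>" if "\<phi> \<in> set ?A" for \<phi>
    using that by (auto simp: similar_args_def)
  have "\<turnstile> fsub \<sigma> (amp_imp ?A \<psi>)"
    by (rule universal_instance[OF ax])
      (use A \<psi> \<sigma>_wf in \<open>auto simp: amp_imp_def intro: wf_amps qfree_amps\<close>)
  then have inst: "\<turnstile> amp_imp (map (fsub \<sigma>) ?A) (fsub \<sigma> \<psi>)"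
    by (simp add: fsub_amp_imp)
  show ?thesis
  proof (rule amp_imp_elim[OF inst])
    fix \<phi> assume "\<phi> \<in> set (map (fsub \<sigma>) ?A)"
    \<comment> \<open>The premise with index \<open>i\<close> pairs variable \<open>i\<close> of the
      first block with variable \<open>n + i\<close> of the second.\<close>
    then obtain i where i: "i < n" and \<phi>: "\<phi> = fsub \<sigma> (Sim G (Var i) (Var (n + i)))"
      by (auto simp: similar_args_def set_zip)
    have "\<phi> = Sim G (ts ! i) (us ! i)"
      using i len by (simp add: \<phi> \<sigma> nth_append)
    moreover have "\<turnstile> Sim G (ts ! i) (us ! i)"
      using sim i len by (simp add: list_all2_conv_all_nth)
    ultimately show "wf_fm \<phi> \<and> \<turnstile> \<phi>"
      using i len wf by (auto simp: subset_iff)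
  qed (use \<psi> \<sigma>_wf in \<open>auto intro: fwf_fsub\<close>)
qed

lemma map_args:
  assumes "length ts = n" "length us = n"
    and "\<sigma> = (\<lambda>x. if x < n + n then (ts @ us) ! x else Var x)"
  shows "map (tsub \<sigma>) (map Var [0..<n]) = ts" "map (tsub \<sigma>) (map Var [n..<n + n]) = us"
  using assms by (auto intro!: nth_equalityI simp: nth_append)

lemma Sim_Fun:
  assumes f: "f \<in> fsyms G" and len: "length ts = f_ar G f" "length us = f_ar G f"
    and wf: "set ts \<subseteq> terms G" "set us \<subseteq> terms G"
    and sim: "list_all2 (\<lambda>t u. \<turnstile> Sim G t u) ts us"
  shows "\<turnstile> Sim G (Fun f ts) (Fun f us)"
proof -
  define n where "n = f_ar G f"
  define \<sigma> where "\<sigma> = (\<lambda>x. if x < n + n then (ts @ us) ! x else Var x)"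
  let ?\<psi> = "Sim G (Fun f (map Var [0..<n])) (Fun f (map Var [n..<n + n])) :: ('c, 'f, 'p) fm"
  have "\<turnstile> Foralls ([0..<n] @ [n..<n + n]) (amp_imp (similar_args G [0..<n] [n..<n + n]) ?\<psi>)"
    by (intro prov.similarity similarity_axioms.func) (auto simp: f n_def)
  then have "\<turnstile> fsub \<sigma> ?\<psi>"
    by (rule similar_instance) (use f len wf sim in \<open>auto simp: n_def \<sigma>_def\<close>)
  then show ?thesis
    using map_args[of ts n us \<sigma>] len by (simp add: n_def \<sigma>_def)
qed

lemma Sim_Pred:
  assumes p: "p \<in> psyms G" and len: "length ts = p_ar G p" "length us = p_ar G p"
    and wf: "set ts \<subseteq> terms G" "set us \<subseteq> terms G"
    and sim: "list_all2 (\<lambda>t u. \<turnstile> Sim G t u) ts us"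
    and prov: "\<turnstile> Pred p ts"
  shows "\<turnstile> Pred p us"
proof -
  define n where "n = p_ar G p"
  define \<sigma> where "\<sigma> = (\<lambda>x. if x < n + n then (ts @ us) ! x else Var x)"
  let ?\<psi> = "Pred p (map Var [0..<n]) \<^bold>\<leftrightarrow> Pred p (map Var [n..<n + n]) :: ('c, 'f, 'p) fm"
  have "\<turnstile> Foralls ([0..<n] @ [n..<n + n]) (amp_imp (similar_args G [0..<n] [n..<n + n]) ?\<psi>)"
    by (intro prov.similarity similarity_axioms.pred) (auto simp: p n_def)
  then have "\<turnstile> fsub \<sigma> ?\<psi>"
    by (rule similar_instance) (use p len wf sim in \<open>auto simp: n_def \<sigma>_def\<close>)
  then have "\<turnstile> Pred p ts \<^bold>\<leftrightarrow> Pred p us"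
    using map_args[of ts n us \<sigma>] len by (simp add: n_def \<sigma>_def)
  \<comment> \<open>The equivalence abbreviates a strong conjunction of two implications; this is
    its first conjunct.\<close>
  then have "\<turnstile> Pred p ts \<^bold>\<rightarrow> Pred p us"
    by (rule amp_elim) (use p len wf in auto)
  from modus_ponens[OF prov this] show ?thesis
    using p len wf by auto
qed


section \<open>Truth in the term structure\<close>

abbreviation cls :: "'f trm \<Rightarrow> 'f trm set" where
  "cls \<equiv> tclass L G \<Phi>"

lemma cls_eq_iff:
  assumes wf: "twf G t" "twf G u"
  shows "cls t = cls u \<longleftrightarrow> \<turnstile> Sim G t u"
proof
  assume "cls t = cls u"
  moreover have "u \<in> cls u"
    using wf by (simp add: tclass_def Sim_refl)
  ultimately show "\<turnstile> Sim G t u"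
    by (auto simp: tclass_def)
next
  assume "\<turnstile> Sim G t u"
  then show "cls t = cls u"
    using wf by (auto simp: tclass_def intro: Sim_trans Sim_sym)
qed

lemma map_cls_eqD:
  assumes "map cls ts = map cls us" "set ts \<subseteq> terms G" "set us \<subseteq> terms G"
  shows "list_all2 (\<lambda>t u. \<turnstile> Sim G t u) ts us"
proof -
  have len: "length ts = length us"
    using map_eq_imp_length_eq[OF assms(1)] .
  have "\<turnstile> Sim G (ts ! i) (us ! i)" if "i < length ts" for i
  proof -
    have "cls (ts ! i) = cls (us ! i)"
      using assms(1) that len by (metis nth_map)
    then show ?thesis
      using that len assms(2,3) by (subst cls_eq_iff[symmetric]) (auto simp: subset_iff)
  qed
  with len show ?thesis
    by (simp add: list_all2_conv_all_nth)
qed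

text \<open>The definite description is well defined: other representatives of the same classes are
  argumentwise similar to \<open>ts\<close>, so \<open>Sim_Fun\<close> gives the same class.\<close>

lemma fun_of_term_struct:
  assumes "f \<in> fsyms G" "length ts = f_ar G f" "set ts \<subseteq> terms G"
  shows "fun_of (term_struct L G \<Phi>) f (map cls ts) = cls (Fun f ts)"
  unfolding term_struct_def struct.simps
proof (rule the_equality)
  show "\<exists>us. set us \<subseteq> terms G \<and> map cls ts = map cls us \<and> cls (Fun f ts) = cls (Fun f us)"
    using assms(3) by blast
  fix d
  assume "\<exists>us. set us \<subseteq> terms G \<and> map cls ts = map cls us \<and> d = cls (Fun f us)"
  then obtain us where us: "set us \<subseteq> terms G" "map cls ts = map cls us" "d = cls (Fun f us)"
    by blast
  have "length us = length ts"
    using map_eq_imp_length_eq[OF us(2)] by simp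
  moreover from this have "\<turnstile> Sim G (Fun f ts) (Fun f us)"
    by (intro Sim_Fun map_cls_eqD) (use assms us in auto)
  ultimately have "cls (Fun f ts) = cls (Fun f us)"
    using assms us(1) by (subst cls_eq_iff) auto
  then show "d = cls (Fun f ts)"
    using us(3) by simp
qed

text \<open>The structure asks for some provable choice of representatives; \<open>Sim_Pred\<close>
  carries provability over to the given ones.\<close>

lemma pred_of_term_struct:
  assumes "p \<in> psyms G" "length ts = p_ar G p" "set ts \<subseteq> terms G"
  shows "pred_of (term_struct L G \<Phi>) p (map cls ts) \<longleftrightarrow> \<turnstile> Pred p ts"
proof
  assume "pred_of (term_struct L G \<Phi>) p (map cls ts)"
  then obtain us where us: "set us \<subseteq> terms G" "map cls ts = map cls us" "\<turnstile> Pred p us"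
    by (auto simp: term_struct_def)
  have "length us = length ts"
    using map_eq_imp_length_eq[OF us(2)] by simp
  moreover have "list_all2 (\<lambda>t u. \<turnstile> Sim G t u) us ts"
    using us assms(3) by (intro map_cls_eqD) auto
  ultimately show "\<turnstile> Pred p ts"
    using assms us by (intro Sim_Pred[of p us ts]) auto
next
  assume "\<turnstile> Pred p ts"
  then show "pred_of (term_struct L G \<Phi>) p (map cls ts)"
    using assms(3) by (auto simp: term_struct_def)
qed

text \<open>Evaluations are represented by substitutions choosing a term in each class, which turns
  evaluation in the structure into syntactic substitution.\<close>

lemma tval_term_struct:
  assumes "twf G t" "\<And>x. twf G (\<sigma> x)"
  shows "tval (term_struct L G \<Phi>) (\<lambda>x. cls (\<sigma> x)) t = cls (tsub \<sigma> t)"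
  using assms(1)
proof (induction t)
  case (Fun f ts)
  then have "map (tval (term_struct L G \<Phi>) (\<lambda>x. cls (\<sigma> x))) ts = map cls (map (tsub \<sigma>) ts)"
    by simp
  then show ?case
    using Fun.prems assms(2)
    by (simp del: map_map) (subst fun_of_term_struct, auto intro: twf_tsub)
qed simp

section \<open>Horn formulas of both kinds, with \<open>cj\<close> as the conjunction\<close>

context
  fixes k :: "'c \<Rightarrow> bool list \<Rightarrow> bool"
    and cj :: "('c, 'f, 'p) fm \<Rightarrow> ('c, 'f, 'p) fm \<Rightarrow> ('c, 'f, 'p) fm"
  assumes cons: "consistent L G \<Phi>" and cj: "cj = Amp \<or> cj = And"
begin

abbreviation holds :: "(nat \<Rightarrow> 'f trm) \<Rightarrow> ('c, 'f, 'p) fm \<Rightarrow> bool" where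
  "holds \<sigma> \<phi> \<equiv> fval (two_alg k) (term_struct L G \<Phi>) (\<lambda>x. cls (\<sigma> x)) \<phi>"

lemma two_alg_simps [simp]:
  "meet (two_alg k) = (\<and>)" "mult (two_alg k) = (\<and>)" "resid (two_alg k) = (\<longrightarrow>)"
  "bottom (two_alg k) = False" "unit (two_alg k) = True"
  by (simp_all add: two_alg_def)

lemma holds_cj: "holds \<sigma> (cj \<phi> \<psi>) \<longleftrightarrow> holds \<sigma> \<phi> \<and> holds \<sigma> \<psi>"
  using cj by auto

text \<open>Together with \<open>holds_cj\<close> this lets strong and weak conjunction be treated
  alike: truth and derivability both split into the conjuncts.\<close>

lemma derivable_cj:
  assumes "wf_fm \<phi>" "wf_fm \<psi>"
  shows "\<turnstile> cj \<phi> \<psi> \<longleftrightarrow> \<turnstile> \<phi> \<and> \<turnstile> \<psi>"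
  using cj assms amp_intro and_intro amp_elim and_elim by metis

lemma wf_cj: "wf_fm (cj \<phi> \<psi>) \<longleftrightarrow> wf_fm \<phi> \<and> wf_fm \<psi>"
  using cj by auto

lemma fsub_cj: "fsub \<sigma> (cj \<phi> \<psi>) = cj (fsub \<sigma> \<phi>) (fsub \<sigma> \<psi>)"
  using cj by auto

lemma qfree_cj: "qfree (cj \<phi> \<psi>) \<longleftrightarrow> qfree \<phi> \<and> qfree \<psi>"
  using cj by auto

lemma holds_atomic_iff:
  assumes "atomic \<phi>" "wf_fm \<phi>" and \<sigma>: "\<And>x. twf G (\<sigma> x)"
  shows "holds \<sigma> \<phi> \<longleftrightarrow> \<turnstile> fsub \<sigma> \<phi>"
  using assms(1)
proof cases
  case (1 p ts)
  have "map (tval (term_struct L G \<Phi>) (\<lambda>x. cls (\<sigma> x))) ts = map cls (map (tsub \<sigma>) ts)"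
    using assms 1 by (simp add: tval_term_struct)
  then show ?thesis
    using assms 1 by (simp del: map_map) (subst pred_of_term_struct, auto intro: twf_tsub)
next
  case 2
  \<comment> \<open>\<open>Zero\<close> is unchanged by substitution, false in the algebra, and
    underivable by consistency.\<close>
  then show ?thesis using cons by (simp add: consistent_def)
next
  case 3
  then show ?thesis by (simp add: derivable_One)
qed

text \<open>The direction from truth to derivability is what the antecedent of a basic Horn formula
  requires.\<close>

lemma holds_conj_of_iff:
  assumes "conj_of cj atomic \<phi>" "wf_fm \<phi>" and \<sigma>: "\<And>x. twf G (\<sigma> x)"
  shows "holds \<sigma> \<phi> \<longleftrightarrow> \<turnstile> fsub \<sigma> \<phi>"
  using assms(1,2)
  by induction
    (auto simp: holds_atomic_iff \<sigma> holds_cj wf_cj fsub_cj derivable_cj fwf_fsub)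

text \<open>Only one direction survives here: an implication may be true because its antecedent is
  underivable, without being derivable itself.\<close>

lemma holds_basic_horn:
  assumes "basic_horn cj \<phi>" "wf_fm \<phi>" and \<sigma>: "\<And>x. twf G (\<sigma> x)" and prov: "\<turnstile> fsub \<sigma> \<phi>"
  shows "holds \<sigma> \<phi>"
  using assms(1)
proof cases
  case 1
  then show ?thesis using assms by (simp add: holds_atomic_iff)
next
  case (2 \<alpha> \<beta>)
  have "holds \<sigma> \<alpha> \<longrightarrow> holds \<sigma> \<beta>"
  proof
    assume "holds \<sigma> \<alpha>"
    then have "\<turnstile> fsub \<sigma> \<alpha>"
      using 2 assms(2) \<sigma> by (simp add: holds_conj_of_iff)
    then have "\<turnstile> fsub \<sigma> \<beta>"
      by (rule modus_ponens) (use prov 2 assms(2) \<sigma> in \<open>auto intro: fwf_fsub\<close>)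
    then show "holds \<sigma> \<beta>"
      using 2 assms(2) \<sigma> by (simp add: holds_atomic_iff)
  qed
  then show ?thesis
    using 2 by simp
qed

lemma holds_qfree_horn:
  assumes "conj_of cj (basic_horn cj) \<phi>" "wf_fm \<phi>" and \<sigma>: "\<And>x. twf G (\<sigma> x)"
    and "\<turnstile> fsub \<sigma> \<phi>"
  shows "holds \<sigma> \<phi>"
  using assms(1,2,4)
  by induction (auto simp: holds_basic_horn \<sigma> holds_cj wf_cj fsub_cj derivable_cj fwf_fsub)

lemma qfree_horn:
  assumes "conj_of cj (basic_horn cj) \<phi>"
  shows "qfree \<phi>"
proof -
  have atomic: "qfree \<phi>" if "atomic \<phi>" for \<phi> :: "('c, 'f, 'p) fm"
    using that by cases auto
  have body: "qfree \<phi>" if "conj_of cj atomic \<phi>" for \<phi>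
    using that by induction (auto simp: atomic qfree_cj)
  have "qfree \<phi>" if "basic_horn cj \<phi>" for \<phi>
    using that by cases (auto simp: atomic body)
  with assms show ?thesis
    by (induction rule: conj_of.induct) (auto simp: qfree_cj)
qed

lemma infimum_two_alg: "infimum (two_alg k) S \<longleftrightarrow> (\<forall>s\<in>S. s)"
proof -
  have "infimum (two_alg k) S = (\<forall>s\<in>S. s)"
    unfolding infimum_def by (rule the_equality) (auto simp: leq_def)
  then show ?thesis by simp
qed

text \<open>Every element of the domain is the class of a term, so changing an evaluation at
  \<open>x\<close> amounts to changing the representing substitution at \<open>x\<close>. Hence the
  assumption ranges over all substitutions by terms.\<close>

lemma holds_Foralls:
  assumes "\<And>\<sigma>. (\<And>x. twf G (\<sigma> x)) \<Longrightarrow> holds \<sigma> \<gamma>" and "\<And>x. twf G (\<sigma> x)"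
  shows "holds \<sigma> (Foralls xs \<gamma>)"
  using assms(2)
proof (induction xs arbitrary: \<sigma>)
  case Nil
  then show ?case using assms(1) by simp
next
  case (Cons x xs)
  have "fval (two_alg k) (term_struct L G \<Phi>) ((\<lambda>y. cls (\<sigma> y))(x := cls t)) (Foralls xs \<gamma>)"
    if "twf G t" for t
    using Cons.IH[of "\<sigma>(x := t)"] Cons.prems that by (simp add: fun_upd_def if_distrib)
  then show ?case
    by (auto simp: infimum_two_alg term_struct_def)
qed

lemma holds_horn:
  assumes "horn cj \<phi>" "wf_fm \<phi>" "\<turnstile> \<phi>" "\<And>x. twf G (\<sigma> x)"
  shows "holds \<sigma> \<phi>"
proof -
  obtain xs \<gamma> where \<phi>: "\<phi> = Foralls xs \<gamma>" and \<gamma>: "conj_of cj (basic_horn cj) \<gamma>"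
    using assms(1) by (auto simp: horn_def)
  have "wf_fm \<gamma>"
    using assms(2) by (simp add: \<phi>)
  with \<gamma> show ?thesis
    unfolding \<phi> using assms(3,4)
    \<comment> \<open>Every instance of the matrix is derivable, hence true; this covers all
      evaluations reached by the quantifier prefix.\<close>
    by (intro holds_Foralls holds_qfree_horn universal_instance[of xs] qfree_horn) (auto simp: \<phi>)
qed

end

end

theorem theorem2:
  fixes L :: "'c plogic" and G :: "('f, 'p) lang"
    and \<Phi> :: "('c, 'f, 'p) fm set" and \<phi> :: "('c, 'f, 'p) fm"
    and k :: "'c \<Rightarrow> bool list \<Rightarrow> bool"
  assumes "core_fuzzy_logic L"
    and "predicate_language G"
    and "\<Phi> \<subseteq> formulas L G"
    and "consistent L G \<Phi>"
    and "\<phi> \<in> formulas L G"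
    and "horn_clause \<phi> \<or> w_horn_clause \<phi>"
    and "prov L G \<Phi> \<phi>"
  shows "fval (two_alg k) (term_struct L G \<Phi>) (canonical_eval L G \<Phi>) \<phi> = unit (two_alg k)"
proof -
  interpret theory_over_core_fuzzy_logic L G \<Phi>
    using assms by unfold_locales
  \<comment> \<open>The canonical evaluation is the one represented by the identity substitution
    \<open>Var\<close>.\<close>
  have "canonical_eval L G \<Phi> = (\<lambda>x. cls (Var x))"
    by (auto simp: canonical_eval_def)
  moreover have "holds k Var \<phi>"
    using assms holds_horn[of Amp] holds_horn[of And] by auto
  ultimately show ?thesis
    by (simp add: two_alg_def)
qed

end
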